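(* There exist a constant $c>0$ and, for infinitely many $n$, a simple undirected unweighted graph $G$ on $n$ nodes together with an initial coloring of its nodes with two colors, such that in the sequential benevolent model the minority process on $G$ has stabilization time at least $c\,n^{3/2}$; that is, every sequence of valid single-node steps starting from the initial coloring and ending in a stable coloring has length at least $c\,n^{3/2}$ (i.e., the stabilization time is $\Omega(n^{3/2})$).
   Context: Let $G$ be a simple, unweighted, undirected graph whose nodes are colored with two colors (black and white). A node $v$ is switchable in the current coloring if, with $v$ currently colored $c_1$, the other color $c_2$ occurs strictly fewer times than $c_1$ among the neighbors of $v$; switching $v$ means changing its color to the color least frequent in its neighborhood (with two colors: to the other color). The minority process is a sequence of steps, each step consisting of a set of nodes that switch simultaneously; a step is valid only if every chosen node is switchable in the coloring before the step. A coloring is stable if no node is switchable, and the stabilization time is the number of steps until a stable coloring is reached. In the sequential benevolent model, each step switches exactly one switchable node, and the order is chosen by a benevolent player who minimizes the number of steps until stabilization; thus the stabilization time is the minimum length of a sequence of valid single-node steps leading to a stable coloring. *)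

theory Defs
  imports Complex_Main "Graph_Theory.Pair_Digraph"
begin

text \<open>
  Finite simple undirected graphs are represented by the locale \<open>pair_graph\<close>: a finite vertex set
  \<open>pverts G\<close> with a symmetric, irreflexive relation \<open>parcs G\<close> on it. Each undirected edge thus
  contributes both of its orientations to \<open>parcs G\<close>.
\<close>

datatype colour = Black | White

fun opposite :: "colour \<Rightarrow> colour" where
  "opposite Black = White"
| "opposite White = Black"

definition neighbours :: "'a pair_pre_digraph \<Rightarrow> 'a \<Rightarrow> 'a set" where
  "neighbours G v = {u. (v, u) \<in> parcs G}"

definition colour_count :: "'a pair_pre_digraph \<Rightarrow> ('a \<Rightarrow> colour) \<Rightarrow> 'a \<Rightarrow> colour \<Rightarrow> nat" where
  "colour_count G col v c = card {u \<in> neighbours G v. col u = c}"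

text \<open>
  Colourings are total functions on the vertex type; their values outside \<open>pverts G\<close> play no role,
  since only vertices of \<open>G\<close> can be switchable.
\<close>

definition switchable :: "'a pair_pre_digraph \<Rightarrow> ('a \<Rightarrow> colour) \<Rightarrow> 'a \<Rightarrow> bool" where
  "switchable G col v \<longleftrightarrow>
     v \<in> pverts G \<and> colour_count G col v (opposite (col v)) < colour_count G col v (col v)"

definition switch :: "'a \<Rightarrow> ('a \<Rightarrow> colour) \<Rightarrow> ('a \<Rightarrow> colour)" where
  "switch v col = col(v := opposite (col v))"

definition stable :: "'a pair_pre_digraph \<Rightarrow> ('a \<Rightarrow> colour) \<Rightarrow> bool" where
  "stable G col \<longleftrightarrow> (\<forall>v \<in> pverts G. \<not> switchable G col v)"

text \<open>A list of vertices is read as the sequence of single-vertex steps in order of execution.\<close>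

fun valid_steps :: "'a pair_pre_digraph \<Rightarrow> ('a \<Rightarrow> colour) \<Rightarrow> 'a list \<Rightarrow> bool" where
  "valid_steps G col [] \<longleftrightarrow> True"
| "valid_steps G col (v # vs) \<longleftrightarrow> switchable G col v \<and> valid_steps G (switch v col) vs"

definition stabilizing :: "'a pair_pre_digraph \<Rightarrow> ('a \<Rightarrow> colour) \<Rightarrow> 'a list \<Rightarrow> bool" where
  "stabilizing G col vs \<longleftrightarrow> valid_steps G col vs \<and> stable G (fold switch vs col)"

definition benevolent_time :: "'a pair_pre_digraph \<Rightarrow> ('a \<Rightarrow> colour) \<Rightarrow> nat" where
  "benevolent_time G col = (LEAST k. \<exists>vs. stabilizing G col vs \<and> length vs = k)"

text \<open>
  Every switch decreases the number of monochromatic arcs, so a stabilizing sequence always exists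
  and the minimum defining \<open>benevolent_time\<close> is attained.
\<close>

definition conflicts :: "'a pair_pre_digraph \<Rightarrow> ('a \<Rightarrow> colour) \<Rightarrow> ('a \<times> 'a) set" where
  "conflicts G col = {(u, w) \<in> parcs G. col u = col w}"

lemma opposite_neq [simp]: "opposite c \<noteq> c" "c \<noteq> opposite c"
  by (cases c; simp)+

context pair_graph
begin

lemma finite_neighbours: "finite (neighbours G v)"
proof (rule finite_subset)
  show "neighbours G v \<subseteq> pverts G"
    by (auto simp: neighbours_def dest: in_arcsD2)
qed (rule pair_finite_verts)

lemma card_conflicts:
  "card (conflicts G col) =
     card {(u, w) \<in> conflicts G col. u \<noteq> v \<and> w \<noteq> v} + 2 * colour_count G col v (col v)"
proof -
  let ?A = "{(u, w) \<in> conflicts G col. u \<noteq> v \<and> w \<noteq> v}"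
  let ?S = "{u \<in> neighbours G v. col u = col v}"
  have "?A \<subseteq> parcs G"
    by (auto simp: conflicts_def)
  then have finA: "finite ?A"
    by (rule finite_subset) (rule pair_finite_arcs)
  have finS: "finite ?S"
    using finite_neighbours by simp
  have sym: "(u, w) \<in> parcs G" if "(w, u) \<in> parcs G" for u w
    using pair_sym_arcs that by (simp add: symmetric_def symD)
  have notin: "v \<notin> ?S"
    using pair_no_loops by (fastforce simp: neighbours_def)
  have split: "conflicts G col = ?A \<union> ({v} \<times> ?S \<union> ?S \<times> {v})"
    by (auto simp: conflicts_def neighbours_def dest: sym)
  have 1: "card (?A \<union> ({v} \<times> ?S \<union> ?S \<times> {v})) = card ?A + card ({v} \<times> ?S \<union> ?S \<times> {v})"
    using finA finS by (intro card_Un_disjoint) auto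
  have 2: "card ({v} \<times> ?S \<union> ?S \<times> {v}) = card ({v} \<times> ?S) + card (?S \<times> {v})"
  proof (rule card_Un_disjoint)
    show "({v} \<times> ?S) \<inter> (?S \<times> {v}) = {}"
      using notin by blast
  qed (use finS in simp_all)
  show ?thesis
    by (subst split, subst 1, subst 2) (simp add: colour_count_def card_cartesian_product)
qed

lemma card_conflicts_switch:
  assumes "switchable G col v"
  shows "card (conflicts G (switch v col)) < card (conflicts G col)"
proof -
  have loop: "(v, v) \<notin> parcs G"
    using pair_no_loops by fastforce
  have "{(u, w) \<in> conflicts G (switch v col). u \<noteq> v \<and> w \<noteq> v}
      = {(u, w) \<in> conflicts G col. u \<noteq> v \<and> w \<noteq> v}"
    by (auto simp: conflicts_def switch_def)
  moreover have "colour_count G (switch v col) v (switch v col v)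
      = colour_count G col v (opposite (col v))"
    unfolding colour_count_def
    by (rule arg_cong[where f = card]) (use loop in \<open>auto simp: switch_def neighbours_def\<close>)
  ultimately show ?thesis
    using assms card_conflicts[of col v] card_conflicts[of "switch v col" v]
    by (simp add: switchable_def)
qed

lemma stabilizing_exists: "\<exists>vs. stabilizing G col vs"
proof (induction "card (conflicts G col)" arbitrary: col rule: less_induct)
  case less
  show ?case
  proof (cases "stable G col")
    case True
    then have "stabilizing G col []"
      by (simp add: stabilizing_def)
    then show ?thesis ..
  next
    case False
    then obtain v where v: "switchable G col v"
      by (auto simp: stable_def)
    from less[OF card_conflicts_switch[OF v]]
    obtain vs where "stabilizing G (switch v col) vs" ..
    with v have "stabilizing G col (v # vs)"
      by (simp add: stabilizing_def)
    then show ?thesis ..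
  qed
qed

lemma benevolent_time_attained:
  "\<exists>vs. stabilizing G col vs \<and> length vs = benevolent_time G col"
  unfolding benevolent_time_def by (rule LeastI_ex) (use stabilizing_exists in blast)

lemma le_benevolent_time_iff:
  "x \<le> real (benevolent_time G col) \<longleftrightarrow> (\<forall>vs. stabilizing G col vs \<longrightarrow> x \<le> real (length vs))"
proof
  assume x: "x \<le> real (benevolent_time G col)"
  show "\<forall>vs. stabilizing G col vs \<longrightarrow> x \<le> real (length vs)"
  proof (intro allI impI)
    fix vs assume "stabilizing G col vs"
    then have "benevolent_time G col \<le> length vs"
      unfolding benevolent_time_def by (intro Least_le) auto
    with x show "x \<le> real (length vs)" by linarith
  qed
next
  assume "\<forall>vs. stabilizing G col vs \<longrightarrow> x \<le> real (length vs)"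
  then show "x \<le> real (benevolent_time G col)"
    using benevolent_time_attained[of col] by auto
qed

end

end

theory Submission
  imports Defs "HOL-Library.Countable"
begin

text \<open>
  The graph is built from blocks, i.e. sets of initially equally coloured nodes, any two of which are either
  completely joined or not joined at all. Each of the \<open>L\<close> waves runs through chain blocks of sizes
  \<open>L + 1, L, \<dots>, 2\<close>: as the predecessor of a chain block exceeds its successor by two nodes, a colour
  change of the predecessor propagates, but only once the predecessor has changed completely.
  The arrival of wave \<open>i\<close> at the far end switches the single trigger node \<open>i + 1\<close>, which switches
  the amplifier \<open>i + 1\<close>, which switches the kicker \<open>i + 1\<close>, which in turn starts the next wave at the
  head of the chain. Triggers, amplifiers and kickers are used only once, so they can draw on energy
  stored in the initial colouring. All balances are tight enough that at every moment
  only the nodes of one block can switch; hence the player has no choice, apart from the order within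
  a block, and \<open>O(L\<^sup>2)\<close> nodes force at least \<open>L\<^sup>3 / 2\<close> steps.
\<close>

section \<open>Spins and switchability\<close>

fun spin :: "colour \<Rightarrow> int" where
  "spin Black = 1"
| "spin White = - 1"

lemma spin_opposite [simp]: "spin (opposite c) = - spin c"
  by (cases c) auto

lemma sum_spin:
  assumes "finite N"
  shows "(\<Sum>u\<in>N. spin (col u))
    = int (card {u \<in> N. col u = Black}) - int (card {u \<in> N. col u = White})"
  using assms
proof (induction N)
  case (insert v N)
  have "{u \<in> insert v N. col u = c}
      = (if col v = c then insert v {u \<in> N. col u = c} else {u \<in> N. col u = c})" for c
    by auto
  with insert show ?case
    by (cases "col v") auto
qed simp

text \<open>The neighbour sum is the black minus the white count; times the node's own spin it is
  the own-colour minus the other-colour count.\<close>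

lemma (in pair_graph) switchable_iff_spin:
  "switchable G col v \<longleftrightarrow>
     v \<in> pverts G \<and> 0 < spin (col v) * (\<Sum>u\<in>neighbours G v. spin (col u))"
  using finite_neighbours[of v]
  by (cases "col v") (auto simp: switchable_def colour_count_def sum_spin)

section \<open>Graphs made of completely joined blocks\<close>

locale blow_up =
  fixes Bs :: "'b set" and nb :: "'b \<Rightarrow> 'b set" and X :: "'b \<Rightarrow> 'v set"
  assumes finite_blocks: "finite Bs"
    and nb_subset: "b \<in> Bs \<Longrightarrow> nb b \<subseteq> Bs"
    and nb_sym: "b \<in> Bs \<Longrightarrow> c \<in> nb b \<Longrightarrow> b \<in> nb c"
    and nb_irrefl: "b \<in> Bs \<Longrightarrow> b \<notin> nb b"
    and finite_block: "b \<in> Bs \<Longrightarrow> finite (X b)"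
    and disjoint: "b \<in> Bs \<Longrightarrow> c \<in> Bs \<Longrightarrow> v \<in> X b \<Longrightarrow> v \<in> X c \<Longrightarrow> b = c"
begin

definition graph :: "'v pair_pre_digraph" where
  "graph = \<lparr>pverts = (\<Union>b\<in>Bs. X b), parcs = (\<Union>b\<in>Bs. \<Union>c\<in>nb b. X b \<times> X c)\<rparr>"

lemma pverts_graph [simp]: "pverts graph = (\<Union>b\<in>Bs. X b)"
  by (simp add: graph_def)

lemma parcs_graph: "(u, v) \<in> parcs graph \<longleftrightarrow> (\<exists>b\<in>Bs. \<exists>c\<in>nb b. u \<in> X b \<and> v \<in> X c)"
  by (auto simp: graph_def)

lemma pair_graph: "pair_graph graph"
proof
  have fin: "finite (pverts graph)"
    using finite_blocks finite_block by simp
  have sub: "parcs graph \<subseteq> pverts graph \<times> pverts graph"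
    using nb_subset by (fastforce simp: parcs_graph)
  show "finite (pverts graph)" by fact
  show "finite (parcs graph)"
    using fin sub by (meson finite_SigmaI finite_subset)
  show "fst e \<in> pverts graph" "snd e \<in> pverts graph" if "e \<in> parcs graph" for e
    using subsetD[OF sub that] by (simp_all only: mem_Times_iff)
  show "fst e \<noteq> snd e" if e: "e \<in> parcs graph" for e
  proof
    assume eq: "fst e = snd e"
    obtain b c where bc: "b \<in> Bs" "c \<in> nb b" "fst e \<in> X b" "snd e \<in> X c"
      using e parcs_graph[of "fst e" "snd e"] by auto
    then have "c \<in> Bs" using nb_subset by blast
    with bc eq have "b = c" using disjoint by metis
    with bc show False using nb_irrefl by blast
  qed
  show "symmetric (with_proj graph)"
    unfolding symmetric_def
    using nb_sym nb_subset by (auto intro!: symI simp: parcs_graph) blast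
qed

sublocale pair_graph graph
  by (rule pair_graph)

lemma neighbours_graph:
  assumes "b \<in> Bs" "v \<in> X b"
  shows "neighbours graph v = (\<Union>c\<in>nb b. X c)"
  using assms disjoint by (fastforce simp: neighbours_def parcs_graph)

text \<open>The neighbour sum seen by every node of \<open>b\<close> when each block
  \<open>c\<close> is uniformly of spin \<open>s c\<close>.\<close>

definition block_field :: "('b \<Rightarrow> int) \<Rightarrow> 'b \<Rightarrow> int" where
  "block_field s b = (\<Sum>c\<in>nb b. int (card (X c)) * s c)"

text \<open>The set \<open>T\<close> collects the nodes of the active block that have already switched.\<close>

definition realises :: "('b \<Rightarrow> int) \<Rightarrow> 'v set \<Rightarrow> ('v \<Rightarrow> colour) \<Rightarrow> bool" where
  "realises s T col \<longleftrightarrow>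
     (\<forall>b\<in>Bs. \<forall>v\<in>X b. spin (col v) = (if v \<in> T then - s b else s b))"

lemma sum_spin_block:
  assumes "realises s T col" "c \<in> Bs"
  shows "(\<Sum>u\<in>X c. spin (col u)) = (int (card (X c)) - 2 * int (card (X c \<inter> T))) * s c"
proof -
  have "(\<Sum>u\<in>X c. spin (col u)) = (\<Sum>u\<in>X c. s c - 2 * s c * of_bool (u \<in> T))"
    using assms by (intro sum.cong) (auto simp: realises_def)
  also have "\<dots> = int (card (X c)) * s c - 2 * s c * int (card (X c \<inter> T))"
    using finite_block[OF assms(2)]
    by (simp add: sum_subtractf flip: sum_distrib_left)
  finally show ?thesis
    by (simp add: algebra_simps)
qed

lemma sum_spin_neighbours:
  assumes "realises s T col" "x \<in> Bs" "T \<subseteq> X x" "b \<in> Bs" "v \<in> X b"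
  shows "(\<Sum>u\<in>neighbours graph v. spin (col u))
    = block_field s b - (if x \<in> nb b then 2 * int (card T) * s x else 0)"
proof -
  have nb: "c \<in> Bs" if "c \<in> nb b" for c
    using that nb_subset assms by blast
  have fin: "finite (nb b)"
    using nb finite_blocks by (meson finite_subset subsetI)
  have T: "X c \<inter> T = (if c = x then T else {})" if "c \<in> nb b" for c
    using assms(2,3) nb[OF that] disjoint by (auto 4 4)
  have "(\<Sum>u\<in>neighbours graph v. spin (col u)) = (\<Sum>c\<in>nb b. \<Sum>u\<in>X c. spin (col u))"
    unfolding neighbours_graph[OF assms(4,5)]
    using fin nb finite_block disjoint by (intro sum.UNION_disjoint) blast+
  also have "\<dots> = (\<Sum>c\<in>nb b. int (card (X c)) * s c - (if c = x then 2 * int (card T) * s x else 0))"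
    using T nb by (intro sum.cong) (auto simp: sum_spin_block[OF assms(1)] algebra_simps)
  also have "\<dots> = block_field s b - (if x \<in> nb b then 2 * int (card T) * s x else 0)"
    using fin by (simp add: sum_subtractf block_field_def)
  finally show ?thesis .
qed

lemma card_graph: "card (pverts graph) \<le> (\<Sum>b\<in>Bs. card (X b))"
  using card_UN_le[OF finite_blocks] by simp

end

section \<open>Schedules that leave the player no choice of block\<close>

locale forced_schedule = blow_up Bs nb X
  for Bs :: "'b set" and nb and X :: "'b \<Rightarrow> 'v set" +
  fixes P :: nat and x :: "nat \<Rightarrow> 'b" and s :: "nat \<Rightarrow> 'b \<Rightarrow> int"
  assumes active_block: "t \<le> P \<Longrightarrow> x t \<in> Bs"
    and active_nonempty: "t \<le> P \<Longrightarrow> X (x t) \<noteq> {}"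
    and unit_spin: "t \<le> P \<Longrightarrow> b \<in> Bs \<Longrightarrow> \<bar>s t b\<bar> = 1"
    and s_Suc: "t < P \<Longrightarrow> b \<in> Bs \<Longrightarrow> s (Suc t) b = (if b = x t then - s t b else s t b)"
    and active_pos: "t \<le> P \<Longrightarrow> 0 < s t (x t) * block_field (s t) (x t)"
    and active_le: "t \<le> P \<Longrightarrow> s t (x t) * block_field (s t) (x t) \<le> 2"
    and inactive: "t \<le> P \<Longrightarrow> b \<in> Bs \<Longrightarrow> b \<noteq> x t \<Longrightarrow> s t b * block_field (s t) b \<le> 0"
begin

lemma block_field_Suc:
  assumes "t < P" "b \<in> Bs"
  shows "block_field (s (Suc t)) b
    = block_field (s t) b - (if x t \<in> nb b then 2 * int (card (X (x t))) * s t (x t) else 0)"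
proof -
  have sub: "nb b \<subseteq> Bs" and fin: "finite (nb b)"
    using nb_subset assms finite_blocks finite_subset by blast+
  have "block_field (s (Suc t)) b = (\<Sum>c\<in>nb b. int (card (X c)) * s t c
      - (if c = x t then 2 * int (card (X (x t))) * s t (x t) else 0))"
    unfolding block_field_def using sub s_Suc[OF assms(1)]
    by (intro sum.cong) (auto simp: algebra_simps)
  then show ?thesis
    using fin by (simp add: sum_subtractf block_field_def)
qed

text \<open>Active nodes are mutually non-adjacent, so their push stays constant. On any other block
  the push is affine in the number of switched nodes, from at most 0 at the start of the phase to at
  most 2 at its end, by \<open>active_le\<close> and \<open>inactive\<close> for
  \<open>Suc t\<close>.\<close>

lemma switchable_iff_active:
  assumes "t < P" and T: "T \<subset> X (x t)" and col: "realises (s t) T col"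
  shows "switchable graph col v \<longleftrightarrow> v \<in> X (x t) - T"
proof (cases "v \<in> pverts graph")
  case False
  then show ?thesis
    using assms active_block[of t] by (auto simp: switchable_iff_spin)
next
  case True
  then obtain b where b: "b \<in> Bs" "v \<in> X b" by auto
  let ?x = "x t" and ?w = "int (card (X (x t)))" and ?m = "int (card T)"
  have x: "?x \<in> Bs" using active_block assms(1) by simp
  have m: "0 \<le> ?m" "?m < ?w"
    using psubset_card_mono[OF finite_block[OF x] T] by auto
  have field: "(\<Sum>u\<in>neighbours graph v. spin (col u))
      = block_field (s t) b - (if ?x \<in> nb b then 2 * ?m * s t ?x else 0)"
    using sum_spin_neighbours[OF col x _ b] T by blast
  have spin: "spin (col v) = (if v \<in> T then - s t b else s t b)"
    using col b by (simp add: realises_def)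
  show ?thesis
  proof (cases "b = ?x")
    case True
    with b x nb_irrefl have "?x \<notin> nb b" by blast
    with True b active_pos[of t] assms(1) show ?thesis
      unfolding switchable_iff_spin field spin by auto
  next
    case False
    then have notx: "v \<notin> X ?x" using b x disjoint by blast
    then have "v \<notin> T" using T by blast
    define p where "p = s t b * block_field (s t) b"
    define d where "d = (if ?x \<in> nb b then - s t b * s t ?x else 0)"
    have "\<bar>d\<bar> \<le> 1"
      using unit_spin[of t b] unit_spin[of t ?x] b x assms(1) by (auto simp: d_def abs_mult)
    then have d: "d = - 1 \<or> d = 0 \<or> d = 1" by linarith
    have p: "p \<le> 0" using inactive[of t b] False b assms(1) by (simp add: p_def)
    have "s (Suc t) b * block_field (s (Suc t)) b = p + 2 * ?w * d"
      using False b by (simp add: block_field_Suc s_Suc assms(1) p_def d_def algebra_simps)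
    moreover have "s (Suc t) b * block_field (s (Suc t)) b \<le> 2"
      using active_le[of "Suc t"] inactive[of "Suc t" b] b assms(1) by fastforce
    ultimately have "p + 2 * ?w * d \<le> 2" by simp
    \<comment> \<open>While a node of the active block is missing, the push on \<open>b\<close> is still smaller by \<open>2\<close>.\<close>
    then have "p + 2 * ?m * d \<le> 0"
      using d p m by auto
    moreover have "spin (col v) * (\<Sum>u\<in>neighbours graph v. spin (col u)) = p + 2 * ?m * d"
      using \<open>v \<notin> T\<close> by (simp add: spin field p_def d_def algebra_simps)
    ultimately show ?thesis
      using notx by (simp add: switchable_iff_spin)
  qed
qed

lemma realises_switch:
  assumes "realises a T col" "v \<notin> T"
  shows "realises a (insert v T) (switch v col)"
  using assms by (auto simp: realises_def switch_def)

lemma realises_next: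
  assumes "t < P" "realises (s t) (X (x t)) col"
  shows "realises (s (Suc t)) {} col"
  using assms active_block[of t] disjoint by (fastforce simp: realises_def s_Suc)

text \<open>By induction on the moves: each adds an active node to \<open>T\<close>, and the one
  filling the block opens the next phase with empty \<open>T\<close>. As \<open>T\<close> is a
  proper subset, some node is switchable before phase \<open>P\<close>, so the list cannot end
  earlier.\<close>

lemma forced_length:
  assumes "t \<le> P" "T \<subset> X (x t)" "realises (s t) T col" "stabilizing graph col vs"
  shows "(\<Sum>r\<in>{t..<P}. card (X (x r))) \<le> card T + length vs"
  using assms
proof (induction vs arbitrary: col T t)
  case Nil
  have "\<not> t < P"
  proof
    assume "t < P"
    then have "\<exists>v. switchable graph col v"
      using switchable_iff_active[OF _ Nil(2,3)] Nil(2) by blast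
    with Nil(4) show False
      by (auto simp: stabilizing_def stable_def switchable_def)
  qed
  then show ?case by simp
next
  case (Cons v vs)
  show ?case
  proof (cases "t < P")
    case True
    have finX: "finite (X (x t))"
      using active_block finite_block Cons.prems(1) by simp
    have v: "v \<in> X (x t)" "v \<notin> T"
      using Cons.prems(4) switchable_iff_active[OF True Cons.prems(2,3)]
      by (auto simp: stabilizing_def)
    have vs: "stabilizing graph (switch v col) vs"
      using Cons.prems(4) by (simp add: stabilizing_def)
    have col: "realises (s t) (insert v T) (switch v col)"
      using Cons.prems(3) v by (intro realises_switch)
    have card: "card (insert v T) = Suc (card T)"
      using v Cons.prems(2) finX finite_subset by (metis card_insert_disjoint psubset_imp_subset)
    show ?thesis
    proof (cases "insert v T = X (x t)")
      case False
      then have "insert v T \<subset> X (x t)"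
        using v Cons.prems(2) by blast
      from Cons.IH[OF Cons.prems(1) this col vs] card show ?thesis by simp
    next
      case filled: True
      have "realises (s (Suc t)) {} (switch v col)"
        using realises_next[OF True] col filled by simp
      then have "(\<Sum>r\<in>{Suc t..<P}. card (X (x r))) \<le> card {} + length vs"
        using vs True active_nonempty[of "Suc t"] Cons.IH[of "Suc t" "{}"] by auto
      moreover have "card (X (x t)) = Suc (card T)"
        using card filled by simp
      ultimately show ?thesis
        using True by (simp add: sum.atLeast_Suc_lessThan)
    qed
  qed simp
qed

lemma exists_initial_colouring:
  "\<exists>col. (\<Sum>r<P. card (X (x r))) \<le> benevolent_time graph col"
proof -
  define col where
    "col v = (if s 0 (THE b. b \<in> Bs \<and> v \<in> X b) = 1 then Black else White)" for v
  have "realises (s 0) {} col"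
    unfolding realises_def
  proof (intro ballI)
    fix b v assume bv: "b \<in> Bs" "v \<in> X b"
    then have "(THE b. b \<in> Bs \<and> v \<in> X b) = b"
      using disjoint by blast
    with unit_spin[of 0 b] bv show "spin (col v) = (if v \<in> {} then - s 0 b else s 0 b)"
      by (auto simp: col_def)
  qed
  with forced_length[of 0 "{}" col] active_nonempty[of 0] benevolent_time_attained[of col]
  show ?thesis
    by (metis atLeast0LessThan card.empty add_0 bot.not_eq_extremum le0)
qed

end

section \<open>The blocks of the wave gadget and their states\<close>

text \<open>
  Amplifier \<open>m\<close> has to switch against the larger kicker \<open>m\<close> on the vote of a single trigger node. The
  pin \<open>m\<close>, itself held in place by the anchor \<open>m\<close>, never switches and cancels the kicker.
\<close>

datatype block =
  Chain nat | Trigger nat | Amplifier nat | Kicker nat | Pin nat | Anchor nat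

instance block :: countable
  by countable_datatype

lemma sum_alternating: "(\<Sum>m\<le>n. (- 1) ^ m :: int) = of_bool (even n)"
  by (induction n) auto

lemma sum_alternating_flipped:
  assumes "even n" "i \<le> Suc n"
  shows "(\<Sum>m\<le>n. if m < i then (- 1) ^ m else - ((- 1) ^ m) :: int) = - ((- 1) ^ i)"
  using assms(2)
proof (induction i)
  case 0
  show ?case using assms(1) by (simp add: sum_negf sum_alternating)
next
  case (Suc i)
  have "(\<Sum>m\<le>n. if m < Suc i then (- 1) ^ m else - ((- 1) ^ m) :: int)
    = (\<Sum>m\<le>n. (if m < i then (- 1) ^ m else - ((- 1) ^ m)) + (if m = i then 2 * (- 1) ^ i else 0))"
    by (intro sum.cong) auto
  also have "\<dots> = - ((- 1) ^ i) + 2 * (- 1) ^ i"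
    using Suc by (simp only: sum.distrib) simp
  finally show ?case by simp
qed

text \<open>Evenness makes the number \<open>L + 1\<close> of kickers, and of triggers, odd, so that
  an alternating family has net spin 1 or -1 however many of its first members are reversed.\<close>

locale wave_gadget =
  fixes L :: nat
  assumes even_L: "even L" and two_le_L: "2 \<le> L"
begin

definition blocks :: "block set" where
  "blocks = Chain ` {1..L} \<union> (\<Union>T\<in>{Trigger, Amplifier, Kicker, Pin, Anchor}. T ` {..L})"

fun weight :: "block \<Rightarrow> nat" where
  "weight (Chain j) = L + 2 - j"
| "weight (Trigger m) = 1"
| "weight (Amplifier m) = L + 3"
| "weight (Kicker m) = L + 2"
| "weight (Pin m) = L + 2"
| "weight (Anchor m) = L + 3"

fun nb :: "block \<Rightarrow> block set" where
  "nb (Chain j) = (if j = 1 then Kicker ` {..L} else {Chain (j - 1)})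
     \<union> (if j = L then Trigger ` {..L} else {Chain (Suc j)})"
| "nb (Trigger m) = {Chain L, Amplifier m} \<union> (if m = 0 then {} else {Kicker (m - 1)})"
| "nb (Amplifier m) = {Trigger m, Kicker m, Pin m}"
| "nb (Kicker m) = {Amplifier m, Chain 1} \<union> (if m = L then {} else {Trigger (Suc m)})"
| "nb (Pin m) = {Amplifier m, Anchor m}"
| "nb (Anchor m) = {Pin m}"

definition nodes :: "block \<Rightarrow> nat set" where
  "nodes b = (\<lambda>k. to_nat (b, k)) ` {..<weight b}"

lemma card_nodes [simp]: "card (nodes b) = weight b"
  unfolding nodes_def by (subst card_image) (auto intro: inj_onI)

sublocale blow_up blocks nb nodes
proof
  show "finite blocks" by (simp add: blocks_def)
  show "nb b \<subseteq> blocks" if "b \<in> blocks" for b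
    using that two_le_L by (cases b) (auto simp: blocks_def image_iff)
  show "b \<in> nb c" if "b \<in> blocks" "c \<in> nb b" for b c
    using that two_le_L
    by (cases b; cases c) (auto simp: blocks_def split: if_splits)
  show "b \<notin> nb b" if "b \<in> blocks" for b
    using that by (cases b) (auto simp: blocks_def)
  show "finite (nodes b)" for b by (simp add: nodes_def)
  show "b = c" if "v \<in> nodes b" "v \<in> nodes c" for b c v
    using that by (auto simp: nodes_def)
qed

text \<open>
  In what follows \<open>i\<close> is the number of the wave and \<open>q < L + 3\<close> the phase within the wave; the block
  \<open>front i q\<close> is the one that switches in this phase.
\<close>

definition front :: "nat \<Rightarrow> nat \<Rightarrow> block" where
  "front i q = (if q = 0 then Amplifier i else if q = 1 then Kicker i
     else if q = L + 2 then Trigger (Suc i) else Chain (q - 1))"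

text \<open>
  The kickers have alternating colours and odd number, so jointly they act on \<open>Chain 1\<close> like one more
  chain block \<open>Chain 0\<close>. In the same way the triggers act on \<open>Chain L\<close> like \<open>Chain (L + 1)\<close>.
\<close>

definition wave_spin :: "nat \<Rightarrow> nat \<Rightarrow> nat \<Rightarrow> int" where
  "wave_spin i q j = (- 1) ^ j * (if j + 2 \<le> q then (- 1) ^ i else - ((- 1) ^ i))"

text \<open>Signs depend on the parity of \<open>m\<close> because consecutive waves recolour the
  chain in opposite ways. Trigger 0 counts as already switched.\<close>

fun st :: "nat \<Rightarrow> nat \<Rightarrow> block \<Rightarrow> int" where
  "st i q (Chain j) = wave_spin i q j"
| "st i q (Trigger m) = (if m < Suc i then (- 1) ^ m else - ((- 1) ^ m))"
| "st i q (Amplifier m) = (if m < i \<or> m = i \<and> 0 < q then - ((- 1) ^ m) else (- 1) ^ m)"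
| "st i q (Kicker m) = (if m < (if 1 < q then Suc i else i) then (- 1) ^ m else - ((- 1) ^ m))"
| "st i q (Pin m) = (- 1) ^ m"
| "st i q (Anchor m) = - ((- 1) ^ m)"

section \<open>The push on each block in each phase\<close>

definition push :: "nat \<Rightarrow> nat \<Rightarrow> block \<Rightarrow> int" where
  "push i q b = st i q b * block_field (st i q) b"

lemma sum_kickers:
  assumes "i \<le> L"
  shows "(\<Sum>c\<in>Kicker ` {..L}. int (weight c) * st i q c) = (int L + 2) * wave_spin i q 0"
  \<comment> \<open>Kicker \<open>i\<close> switches in phase 1, so \<open>Suc i\<close> kickers
    have switched from phase 2 on.\<close>
  using sum_alternating_flipped[OF even_L, of "if 1 < q then Suc i else i"] assms
  by (auto simp: sum.reindex inj_on_def wave_spin_def simp flip: sum_distrib_left)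

text \<open>Trigger \<open>Suc i\<close> switches in the last phase of wave \<open>i\<close>, so
  during the wave the triggers act like a chain block not yet reached.\<close>

lemma sum_triggers:
  assumes "i \<le> L" "q < L + 3"
  shows "(\<Sum>c\<in>Trigger ` {..L}. int (weight c) * st i q c) = wave_spin i q (Suc L)"
  using sum_alternating_flipped[OF even_L, of "Suc i"] assms even_L
  by (auto simp: sum.reindex inj_on_def wave_spin_def)

lemma block_field_Chain:
  assumes "i \<le> L" "q < L + 3" "1 \<le> j" "j \<le> L"
  shows "block_field (st i q) (Chain j)
    = (int L + 3 - int j) * wave_spin i q (j - 1) + (int L + 1 - int j) * wave_spin i q (Suc j)"
proof -
  let ?f = "\<lambda>c. int (weight c) * st i q c"
  let ?l = "if j = 1 then Kicker ` {..L} else {Chain (j - 1)}"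
  let ?r = "if j = L then Trigger ` {..L} else {Chain (Suc j)}"
  have "block_field (st i q) (Chain j) = sum ?f (?l \<union> ?r)"
    by (simp add: block_field_def)
  also have "\<dots> = sum ?f ?l + sum ?f ?r"
    by (rule sum.union_disjoint) auto
  also have "sum ?f ?l = (int L + 3 - int j) * wave_spin i q (j - 1)"
    using sum_kickers[OF assms(1)] assms by (auto simp: of_nat_diff)
  also have "sum ?f ?r = (int L + 1 - int j) * wave_spin i q (Suc j)"
    using sum_triggers[OF assms(1,2)] assms by (auto simp: of_nat_diff)
  finally show ?thesis .
qed

lemma minus_one_power_cases: "(- 1 :: int) ^ m = 1 \<or> (- 1 :: int) ^ m = - 1"
  by (cases "even m") auto

text \<open>Only at the front does a chain block agree with its predecessor, which outweighs the
  successor by 2; elsewhere the predecessor opposes it and prevails.\<close>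

lemma push_Chain:
  assumes "i \<le> L" "q < L + 3" "1 \<le> j" "j \<le> L"
  shows "q = Suc j \<Longrightarrow> push i q (Chain j) = 2" "q \<noteq> Suc j \<Longrightarrow> push i q (Chain j) \<le> 0"
proof -
  obtain k where j: "j = Suc k" using assms by (cases j) auto
  show "q = Suc j \<Longrightarrow> push i q (Chain j) = 2" "q \<noteq> Suc j \<Longrightarrow> push i q (Chain j) \<le> 0"
    unfolding push_def block_field_Chain[OF assms]
    using minus_one_power_cases[of i] minus_one_power_cases[of k] assms
    by (auto simp: j wave_spin_def)
qed

text \<open>For positive \<open>m\<close>, amplifier \<open>m\<close> outweighs kicker
  \<open>m - 1\<close> by only 1, so when these two disagree the two nodes of \<open>Chain L\<close>
  decide: the trigger waits for the wave to arrive.\<close>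

lemma push_Trigger:
  assumes "i < L" "q < L + 3" "i \<noteq> 0 \<or> q \<noteq> 0" "m \<le> L"
  shows "m = Suc i \<and> q = L + 2 \<Longrightarrow> push i q (Trigger m) = 1"
    "\<not> (m = Suc i \<and> q = L + 2) \<Longrightarrow> push i q (Trigger m) \<le> 0"
proof -
  have field: "block_field (st i q) (Trigger m)
      = 2 * wave_spin i q L + (int L + 3) * st i q (Amplifier m)
        + (if m = 0 then 0 else (int L + 2) * st i q (Kicker (m - 1)))"
    by (auto simp: block_field_def)
  show "m = Suc i \<and> q = L + 2 \<Longrightarrow> push i q (Trigger m) = 1"
    unfolding push_def field using minus_one_power_cases[of i] even_L
    by (auto simp: wave_spin_def)
  assume *: "\<not> (m = Suc i \<and> q = L + 2)"
  show "push i q (Trigger m) \<le> 0"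
  proof (cases m)
    case 0
    then show ?thesis
      unfolding push_def field using minus_one_power_cases[of i] assms(3) even_L
      by (auto simp: wave_spin_def)
  next
    case (Suc k)
    consider "k < i" "m < i" | "m = i" | "k = i" | "i < k" using Suc by linarith
    then show ?thesis
      unfolding push_def field
      using minus_one_power_cases[of i] minus_one_power_cases[of k] even_L * assms(2)
      by cases (auto simp: wave_spin_def Suc)
  qed
qed

text \<open>Kicker and pin cancel until the kicker switches; from then on both hold the amplifier at
  its new colour.\<close>

lemma push_Amplifier:
  shows "m = i \<and> q = 0 \<Longrightarrow> push i q (Amplifier m) = 1"
    "\<not> (m = i \<and> q = 0) \<Longrightarrow> push i q (Amplifier m) \<le> 0"
proof -
  have field: "block_field (st i q) (Amplifier m)
      = st i q (Trigger m) + (int L + 2) * (st i q (Kicker m) + st i q (Pin m))"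
    by (simp add: block_field_def algebra_simps del: st.simps)
  show "m = i \<and> q = 0 \<Longrightarrow> push i q (Amplifier m) = 1"
    unfolding push_def field using minus_one_power_cases[of i] by auto
  assume *: "\<not> (m = i \<and> q = 0)"
  consider "m < i" | "m = i" | "i < m" by linarith
  then show "push i q (Amplifier m) \<le> 0"
    unfolding push_def field using minus_one_power_cases[of m] *
    by cases auto
qed

text \<open>The amplifier outweighs \<open>Chain 1\<close> and the next trigger together by 1, so
  the kicker obeys its amplifier alone.\<close>

lemma push_Kicker:
  assumes "i < L" "m \<le> L"
  shows "m = i \<and> q = 1 \<Longrightarrow> push i q (Kicker m) = 1"
    "\<not> (m = i \<and> q = 1) \<Longrightarrow> push i q (Kicker m) \<le> 0"
proof -
  have field: "block_field (st i q) (Kicker m)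
      = (int L + 3) * st i q (Amplifier m) + (int L + 1) * wave_spin i q 1
        + (if m = L then 0 else st i q (Trigger (Suc m)))"
    by (auto simp: block_field_def)
  show "m = i \<and> q = 1 \<Longrightarrow> push i q (Kicker m) = 1"
    unfolding push_def field using minus_one_power_cases[of i] assms(1)
    by (auto simp: wave_spin_def)
  assume *: "\<not> (m = i \<and> q = 1)"
  consider "m < i" | "m = i" "q = 0" | "m = i" "1 < q" | "i < m" using * by linarith
  then show "push i q (Kicker m) \<le> 0"
    unfolding push_def field
    using minus_one_power_cases[of m] minus_one_power_cases[of i] assms
    by cases (auto simp: wave_spin_def)
qed

lemma push_Pin: "push i q (Pin m) \<le> 0"
  using minus_one_power_cases[of m] by (auto simp: push_def block_field_def)

lemma push_Anchor: "push i q (Anchor m) \<le> 0"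
  using minus_one_power_cases[of m] by (auto simp: push_def block_field_def)

lemma push_front:
  assumes "i < L" "q < L + 3" "i \<noteq> 0 \<or> q \<noteq> 0"
  shows "push i q (front i q) \<in> {1, 2}"
  using push_Trigger(1)[OF assms, of "Suc i"] push_Amplifier(1)[of i i q] push_Kicker(1)[of i i q]
    push_Chain(1)[of i q "q - 1"] assms
  by (auto simp: front_def)

lemma push_not_front:
  assumes "i < L" "q < L + 3" "i \<noteq> 0 \<or> q \<noteq> 0" "b \<in> blocks" "b \<noteq> front i q"
  shows "push i q b \<le> 0"
proof (cases b)
  case (Chain j)
  then show ?thesis
    using push_Chain(2)[of i q j] assms by (auto simp: blocks_def front_def split: if_splits)
next
  case (Trigger m)
  then show ?thesis
    using push_Trigger(2)[OF assms(1-3), of m] assms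
    by (auto simp: blocks_def front_def split: if_splits)
next
  case (Amplifier m)
  then show ?thesis
    using push_Amplifier(2)[of m i q] assms
    by (auto simp: blocks_def front_def split: if_splits)
next
  case (Kicker m)
  then show ?thesis
    using push_Kicker(2)[OF assms(1), of m q] assms
    by (auto simp: blocks_def front_def split: if_splits)
qed (simp_all add: push_Pin push_Anchor)

section \<open>Consecutive phases on one time axis\<close>

definition state :: "nat \<Rightarrow> block \<Rightarrow> int" where
  "state t = st (t div (L + 3)) (t mod (L + 3))"

definition active :: "nat \<Rightarrow> block" where
  "active t = front (t div (L + 3)) (t mod (L + 3))"

lemma st_Suc:
  assumes "Suc q < L + 3" "b \<in> blocks"
  shows "st i (Suc q) b = (if b = front i q then - st i q b else st i q b)"
  using assms by (cases b) (auto simp: front_def wave_spin_def blocks_def less_Suc_eq)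

lemma st_next_wave:
  assumes "b \<in> blocks"
  shows "st (Suc i) 0 b = (if b = front i (L + 2) then - st i (L + 2) b else st i (L + 2) b)"
  using assms by (cases b) (auto simp: front_def wave_spin_def blocks_def)

lemma state_Suc:
  assumes "b \<in> blocks"
  shows "state (Suc t) b = (if b = active t then - state t b else state t b)"
proof (cases "Suc (t mod (L + 3)) = L + 3")
  case True
  then have "t mod (L + 3) = L + 2" "Suc t mod (L + 3) = 0"
    "Suc t div (L + 3) = Suc (t div (L + 3))"
    by (simp_all only: mod_Suc div_Suc) simp_all
  with st_next_wave[OF assms] show ?thesis
    by (simp only: state_def active_def)
next
  case False
  then have "Suc t mod (L + 3) = Suc (t mod (L + 3))" "Suc t div (L + 3) = t div (L + 3)"
    by (simp_all only: mod_Suc div_Suc) simp_all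
  moreover have "Suc (t mod (L + 3)) < L + 3"
    using False mod_less_divisor[of "L + 3" t] by linarith
  ultimately show ?thesis
    using st_Suc[OF _ assms] by (simp only: state_def active_def)
qed

lemma front_in_blocks: "i < L \<Longrightarrow> q < L + 3 \<Longrightarrow> front i q \<in> blocks"
  by (auto simp: front_def blocks_def image_iff)

lemma weight_front: "q < L + 3 \<Longrightarrow> weight (front i q) = L + 3 - q"
  by (auto simp: front_def)

lemma weight_active: "weight (active t) = L + 3 - t mod (L + 3)"
  by (simp add: active_def weight_front)

lemma wave_bounds:
  assumes "t < L * (L + 3)" "0 < t"
  shows "t div (L + 3) < L" "t mod (L + 3) < L + 3" "t div (L + 3) \<noteq> 0 \<or> t mod (L + 3) \<noteq> 0"
proof -
  show "t div (L + 3) < L" using assms by (simp add: less_mult_imp_div_less)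
  show "t mod (L + 3) < L + 3" by simp
  show "t div (L + 3) \<noteq> 0 \<or> t mod (L + 3) \<noteq> 0"
    using assms(2) div_mult_mod_eq[of t "L + 3"] by (metis add_0 mult_0 less_irrefl)
qed

text \<open>
  Time starts at \<open>1\<close>: trigger \<open>0\<close> has no preceding kicker, so it would be switchable
  while amplifier \<open>0\<close> has not switched yet.
\<close>

lemma forced_schedule:
  "forced_schedule blocks nb nodes (L * (L + 3) - 2) (\<lambda>t. active (Suc t)) (\<lambda>t. state (Suc t))"
proof unfold_locales
  fix t assume "t \<le> L * (L + 3) - 2"
  moreover have "2 * 1 \<le> L * (L + 3)"
    using two_le_L by (intro mult_le_mono) auto
  \<comment> \<open>The end of the schedule is included, so \<open>Suc t\<close> reaches
    \<open>L * (L + 3) - 1\<close>, the last phase of wave \<open>L - 1\<close>.\<close>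
  ultimately have t: "Suc t < L * (L + 3)" by linarith
  note bounds = wave_bounds[OF t zero_less_Suc]
  show "active (Suc t) \<in> blocks"
    unfolding active_def using bounds by (intro front_in_blocks)
  have "0 < weight (active (Suc t))"
    unfolding weight_active using bounds(2) by linarith
  then show "nodes (active (Suc t)) \<noteq> {}"
    by (metis card.empty card_nodes less_irrefl)
  show "\<bar>state (Suc t) b\<bar> = 1" for b
    by (cases b) (auto simp: state_def wave_spin_def abs_mult power_abs)
  show "0 < state (Suc t) (active (Suc t)) * block_field (state (Suc t)) (active (Suc t))"
    "state (Suc t) (active (Suc t)) * block_field (state (Suc t)) (active (Suc t)) \<le> 2"
    using push_front[OF bounds] unfolding push_def state_def active_def by auto
  show "state (Suc t) b * block_field (state (Suc t)) b \<le> 0"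
    if "b \<in> blocks" "b \<noteq> active (Suc t)" for b
    using push_not_front[OF bounds that[unfolded active_def]] unfolding push_def state_def .
qed (simp add: state_Suc)

section \<open>Counting steps and nodes\<close>

lemma sum_descending: "2 * (\<Sum>q<n. n - q) = n * Suc (n :: nat)"
proof (induction n)
  case (Suc n)
  then show ?case
    by (subst sum.lessThan_Suc_shift) (simp add: algebra_simps)
qed simp

lemma sum_weight_active: "2 * (\<Sum>t<N * (L + 3). weight (active t)) = N * ((L + 3) * (L + 4))"
proof -
  have wave: "(\<Sum>t\<in>{i * (L + 3)..<i * (L + 3) + (L + 3)}. weight (active t)) = (\<Sum>q<L + 3. L + 3 - q)" for i
    using sum.shift_bounds_nat_ivl[of "\<lambda>t. weight (active t)" 0 "i * (L + 3)" "L + 3"]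
    by (simp add: weight_active atLeast0LessThan add.commute cong: sum.cong_simp)
  show ?thesis
    unfolding sum.nat_group[symmetric] wave
    using sum_descending[of "L + 3"] by (simp add: algebra_simps)
qed

lemma long_stabilization: "\<exists>col. L ^ 3 \<le> 2 * benevolent_time graph col"
proof -
  interpret forced_schedule blocks nb nodes "L * (L + 3) - 2" "\<lambda>t. active (Suc t)" "\<lambda>t. state (Suc t)"
    by (rule forced_schedule)
  let ?w = "\<lambda>t. weight (active t)"
  define N where "N = L * (L + 3) - 2"
  have "2 * 1 \<le> L * (L + 3)"
    using two_le_L by (intro mult_le_mono) auto
  then have N: "L * (L + 3) = Suc (Suc N)" by (simp add: N_def)
  \<comment> \<open>Times 0 and \<open>Suc N\<close> are not counted by the schedule; their blocks
    have at most \<open>L + 3\<close> nodes each.\<close>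
  have "(\<Sum>t<L * (L + 3). ?w t) = ?w 0 + (\<Sum>t<N. ?w (Suc t)) + ?w (Suc N)"
    unfolding N sum.lessThan_Suc_shift[of _ "Suc N"] by simp
  also have "\<dots> \<le> (\<Sum>t<N. ?w (Suc t)) + 2 * (L + 3)"
    by (simp add: weight_active)
  finally have "L * ((L + 3) * (L + 4)) \<le> 2 * (\<Sum>t<N. ?w (Suc t)) + 4 * (L + 3)"
    using sum_weight_active[of L] by linarith
  moreover have "L ^ 3 + 4 * (L + 3) \<le> L * ((L + 3) * (L + 4))"
  proof -
    have "2 * L \<le> L * L" using two_le_L by simp
    then show ?thesis
      using two_le_L by (simp add: algebra_simps power3_eq_cube)
  qed
  ultimately have "L ^ 3 \<le> 2 * (\<Sum>t<N. ?w (Suc t))"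
    by linarith
  moreover obtain col where "(\<Sum>t<N. ?w (Suc t)) \<le> benevolent_time graph col"
    using exists_initial_colouring by (auto simp: N_def)
  ultimately show ?thesis
    by (intro exI[of _ col]) linarith
qed

lemma card_pverts_le: "card (pverts graph) \<le> 36 * L ^ 2"
proof -
  have "card blocks \<le> card (Chain ` {1..L})
      + card (\<Union>T\<in>{Trigger, Amplifier, Kicker, Pin, Anchor}. T ` {..L})"
    unfolding blocks_def by (rule card_Un_le)
  also have "card (\<Union>T\<in>{Trigger, Amplifier, Kicker, Pin, Anchor}. T ` {..L})
      \<le> (\<Sum>T\<in>{Trigger, Amplifier, Kicker, Pin, Anchor}. card (T ` {..L}))"
    by (rule card_UN_le) simp
  also have "\<dots> \<le> (\<Sum>T\<in>{Trigger, Amplifier, Kicker, Pin, Anchor}. Suc L)"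
    using card_image_le[of "{..L}"] by (intro sum_mono) simp
  also have "\<dots> \<le> 5 * Suc L"
    using mult_le_mono1[OF card_length[of "[Trigger, Amplifier, Kicker, Pin, Anchor]"], of "Suc L"]
    by simp
  finally have "card blocks \<le> 6 * L + 5"
    using card_image_le[of "{1..L}" Chain] by simp
  also have "\<dots> \<le> 9 * L" using two_le_L by simp
  finally have blocks: "card blocks \<le> 9 * L" by simp
  have "weight b \<le> 4 * L" for b
    using two_le_L by (cases b) auto
  then have "(\<Sum>b\<in>blocks. weight b) \<le> card blocks * (4 * L)"
    using sum_bounded_above[of blocks weight "4 * L"] by simp
  also have "\<dots> \<le> 9 * L * (4 * L)"
    using blocks by (intro mult_le_mono) auto
  finally show ?thesis
    using card_graph by (simp add: power2_eq_square)
qed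

text \<open>Makes the sizes unbounded, which yields infinitely many \<open>n\<close>.\<close>

lemma card_pverts_gt: "L < card (pverts graph)"
proof -
  have "Kicker 0 \<in> blocks" by (simp add: blocks_def)
  then have "nodes (Kicker 0) \<subseteq> pverts graph" by auto
  then have "card (nodes (Kicker 0)) \<le> card (pverts graph)"
    using pair_finite_verts by (rule card_mono[rotated])
  then show ?thesis by simp
qed

text \<open>At most \<open>36 * L ^ 2\<close> nodes have 3/2-th power at most
  \<open>216 * L ^ 3\<close>, and \<open>L ^ 3\<close> is at most twice the time; hence 432.\<close>

lemma lower_bound:
  "\<exists>col. 1 / 432 * real (card (pverts graph)) powr (3 / 2) \<le> real (benevolent_time graph col)"
proof -
  obtain col where col: "L ^ 3 \<le> 2 * benevolent_time graph col"
    using long_stabilization ..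
  have "real (card (pverts graph)) \<le> (6 * real L) powr 2"
    using card_pverts_le two_le_L by (simp add: power_mult_distrib flip: of_nat_power of_nat_mult)
  then have "real (card (pverts graph)) powr (3 / 2) \<le> ((6 * real L) powr 2) powr (3 / 2)"
    by (intro powr_mono2) auto
  also have "\<dots> = (6 * real L) powr 3"
    unfolding powr_powr by simp
  also have "\<dots> = 216 * real (L ^ 3)"
    using two_le_L by (simp add: power_mult_distrib)
  also have "\<dots> \<le> 432 * real (benevolent_time graph col)"
    using col by linarith
  finally show ?thesis
    by (intro exI[of _ col]) simp
qed

end

theorem theorem2:
  shows "\<exists>c::real. c > 0 \<and>
    (\<exists>\<^sub>\<infinity>n::nat. \<exists>(G :: nat pair_pre_digraph) (col :: nat \<Rightarrow> colour).
       pair_graph G \<and> card (pverts G) = n \<and>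
       c * real n powr (3/2) \<le> real (benevolent_time G col))"
proof (intro exI[of _ "1 / 432"] conjI)
  show "\<exists>\<^sub>\<infinity>n::nat. \<exists>(G :: nat pair_pre_digraph) (col :: nat \<Rightarrow> colour).
       pair_graph G \<and> card (pverts G) = n \<and>
       1 / 432 * real n powr (3/2) \<le> real (benevolent_time G col)"
    unfolding INFM_nat
  proof
    fix m :: nat
    \<comment> \<open>This parameter is even, at least 2 and larger than \<open>m\<close>, so the
      graph has more than \<open>m\<close> nodes.\<close>
    interpret wave_gadget "2 * Suc m"
      by unfold_locales auto
    show "\<exists>n>m. \<exists>(G :: nat pair_pre_digraph) (col :: nat \<Rightarrow> colour).
       pair_graph G \<and> card (pverts G) = n \<and>
       1 / 432 * real n powr (3/2) \<le> real (benevolent_time G col)"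
      using lower_bound pair_graph card_pverts_gt
      by (intro exI[of _ "card (pverts graph)"] conjI exI[of _ graph]) auto
  qed
qed simp

end
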